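(* Let $c_i>0$, $G_i>0$, $F_i>0$, $c_{ij}\ge0$, $d_{ij}\ge0$, $e_{ij}\ge0$ be real numbers, $i,j=1,\dots,n$. Suppose there exist $\xi_i>0$, real $\alpha_{ij},\beta_{ij}$, and $p>1$, $q>1$ with $\frac1p+\frac1q=1$ such that for every $i=1,\dots,n$ $$-c_i\xi_i+\frac1p\sum_{j\ne i}c_{ji}^{\alpha_{ji}p}G_i\xi_j+\frac1q\sum_{j\ne i}c_{ij}^{(1-\alpha_{ij})q}G_j\xi_i+\frac1p\sum_{j\ne i}d_{ji}^{\beta_{ji}p}e_{ji}F_i\xi_j+\frac1q\sum_{j\ne i}d_{ij}^{(1-\beta_{ij})q}e_{ij}F_j\xi_i\le 0 .$$ Then there exist constants $\theta_i>0$ ($i=1,\dots,n$) such that for every $i=1,\dots,n$ $$-c_i\theta_i+G_i\sum_{j\ne i}\theta_jc_{ji}+F_i\sum_{j\ne i}\theta_jd_{ji}e_{ji}\le 0 .$$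
   Context: All quantities are real numbers; sums over $j\ne i$ run over $j\in\{1,\dots,n\}\setminus\{i\}$. *)

theory Defs
  imports Complex_Main
begin

end

theory Submission imports Defs "HOL-Analysis.Convex" begin

text \<open>
  Put \<open>m\<^sub>j\<^sub>i = G\<^sub>i c\<^sub>j\<^sub>i + F\<^sub>i d\<^sub>j\<^sub>i e\<^sub>j\<^sub>i\<close>. The conclusion asks for a strictly positive row vector \<open>\<theta>\<close>
  with \<open>\<theta> N \<ge> 0\<close>, where \<open>N\<close> has the diagonal \<open>c\<close> and the off-diagonal entries \<open>-m\<^sub>j\<^sub>i\<close>.
  By linear duality (lemma \<open>positive_row_vector_or_nonpos_image\<close>, which rests on Farkas' lemma)
  such a \<open>\<theta>\<close> exists unless there is a column vector \<open>x \<ge> 0\<close> with \<open>N x \<le> 0\<close> and \<open>N x \<noteq> 0\<close>. Spectral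
  arguments would give the weaker statement that \<open>N\<close> is a limit of nonsingular M-matrices; when
  \<open>N\<close> is reducible this does not produce a vector without zero entries, whereas duality does.

  Such an \<open>x\<close> is excluded by testing the hypothesis against \<open>x\<^sub>i\<^sup>p\<close>. Move \<open>c\<^sub>i \<xi>\<^sub>i\<close> to the right of the
  \<open>i\<close>-th inequality, multiply by \<open>x\<^sub>i\<^sup>p\<close>, add over \<open>i\<close>, and interchange the summations in the terms
  that carry \<open>1/p\<close>, so that every pair of indices has the common factor \<open>\<xi>\<^sub>j\<close>. Young's inequality for
  each pair then bounds the left-hand side below by \<open>\<Sum>\<^sub>j \<xi>\<^sub>j x\<^sub>j\<^sup>p\<^sup>-\<^sup>1 (m x)\<^sub>j\<close>. Since \<open>N x \<le> 0\<close>, this is at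
  least \<open>\<Sum>\<^sub>j \<xi>\<^sub>j c\<^sub>j x\<^sub>j\<^sup>p\<close>, which is the right-hand side.
  The component in which \<open>N x\<close> is negative makes the bound strict, a contradiction
  (lemma \<open>no_nonpos_image\<close>).
\<close>

section \<open>Linear duality\<close>

text \<open>
  The induction removes one inequality \<open>a\<^sub>k\<close>. Either it is redundant, or there is a vector \<open>y\<close>
  with \<open>b y > 0\<close> that violates only \<open>a\<^sub>k\<close>, normalised to \<open>a\<^sub>k y = 1\<close>. Projecting along \<open>y\<close> onto the
  kernel of \<open>a\<^sub>k\<close> reduces to the remaining inequalities, and the coefficient that \<open>a\<^sub>k\<close> receives,
  \<open>b y - \<Sum>\<^sub>i \<lambda>\<^sub>i (a\<^sub>i y)\<close>, is nonnegative by the choice of \<open>y\<close>.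
\<close>
lemma farkas:
  fixes a :: "'i \<Rightarrow> 'j \<Rightarrow> real" and b :: "'j \<Rightarrow> real"
  assumes "finite I" "finite J"
    and "\<And>x. (\<And>i. i \<in> I \<Longrightarrow> (\<Sum>j\<in>J. a i j * x j) \<le> 0) \<Longrightarrow> (\<Sum>j\<in>J. b j * x j) \<le> 0"
  shows "\<exists>l. (\<forall>i\<in>I. 0 \<le> l i) \<and> (\<forall>j\<in>J. b j = (\<Sum>i\<in>I. l i * a i j))"
  using assms(1,3)
proof (induction I arbitrary: a b rule: finite_induct)
  case empty
  have "(\<Sum>j\<in>J. b j * b j) \<le> 0"
    by (rule empty.prems) auto
  moreover have "(\<Sum>j\<in>J. b j * b j) \<ge> 0"
    by (intro sum_nonneg) auto
  ultimately have "(\<Sum>j\<in>J. b j * b j) = 0"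
    by linarith
  then show ?case
    using assms(2) by (auto simp: sum_nonneg_eq_0_iff)
next
  case (insert k I)
  show ?case
  proof (cases "\<forall>x. (\<forall>i\<in>I. (\<Sum>j\<in>J. a i j * x j) \<le> 0) \<longrightarrow> (\<Sum>j\<in>J. b j * x j) \<le> 0")
    case True
    then obtain l where l: "\<forall>i\<in>I. 0 \<le> l i" "\<forall>j\<in>J. b j = (\<Sum>i\<in>I. l i * a i j)"
      using insert.IH[of a b] by auto
    have "(\<Sum>i\<in>I. (l(k := 0)) i * a i j) = (\<Sum>i\<in>I. l i * a i j)" for j
      using insert.hyps by (intro sum.cong) auto
    then show ?thesis
      using l insert.hyps by (intro exI[of _ "l(k := 0)"]) auto
  next
    case False
    then obtain z where z: "\<And>i. i \<in> I \<Longrightarrow> (\<Sum>j\<in>J. a i j * z j) \<le> 0" "(\<Sum>j\<in>J. b j * z j) > 0"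
      by (auto simp: not_le)
    define s where "s = (\<Sum>j\<in>J. a k j * z j)"
    have s: "s > 0"
      using insert.prems[of z] z unfolding s_def by fastforce
    define y where "y = (\<lambda>j. z j / s)"
    define A where "A i = (\<Sum>j\<in>J. a i j * y j)" for i
    define B where "B = (\<Sum>j\<in>J. b j * y j)"
    have A: "A i \<le> 0" if "i \<in> I" for i
      using z(1)[OF that] s
      by (simp add: A_def y_def divide_nonpos_pos flip: sum_divide_distrib)
    have B: "B > 0"
      using z(2) s by (simp add: B_def y_def flip: sum_divide_distrib)
    have Ak: "A k = 1"
      using s by (simp add: A_def y_def flip: sum_divide_distrib s_def)
    have "\<exists>l. (\<forall>i\<in>I. 0 \<le> l i) \<and>
        (\<forall>j\<in>J. b j - B * a k j = (\<Sum>i\<in>I. l i * (a i j - A i * a k j)))"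
    proof (rule insert.IH)
      fix x assume x: "\<And>i. i \<in> I \<Longrightarrow> (\<Sum>j\<in>J. (a i j - A i * a k j) * x j) \<le> 0"
      define t where "t = (\<Sum>j\<in>J. a k j * x j)"
      have project: "(\<Sum>j\<in>J. f j * (x j - t * y j))
          = (\<Sum>j\<in>J. (f j - (\<Sum>j\<in>J. f j * y j) * a k j) * x j)" for f
      proof -
        have "(\<Sum>j\<in>J. f j * (x j - t * y j)) = (\<Sum>j\<in>J. f j * x j) - t * (\<Sum>j\<in>J. f j * y j)"
          by (simp add: sum_subtractf sum_distrib_left algebra_simps)
        also have "\<dots> = (\<Sum>j\<in>J. (f j - (\<Sum>j\<in>J. f j * y j) * a k j) * x j)"
          by (simp add: t_def left_diff_distrib sum_subtractf mult.assoc flip: sum_distrib_left)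
        finally show ?thesis .
      qed
      have "(\<Sum>j\<in>J. b j * (x j - t * y j)) \<le> 0"
      proof (rule insert.prems)
        fix i assume "i \<in> insert k I"
        then show "(\<Sum>j\<in>J. a i j * (x j - t * y j)) \<le> 0"
          using x[of i] Ak unfolding project by (auto simp flip: A_def)
      qed
      then show "(\<Sum>j\<in>J. (b j - B * a k j) * x j) \<le> 0"
        unfolding project by (simp flip: B_def)
    qed
    then obtain l where l: "\<And>i. i \<in> I \<Longrightarrow> 0 \<le> l i"
        "\<And>j. j \<in> J \<Longrightarrow> b j - B * a k j = (\<Sum>i\<in>I. l i * (a i j - A i * a k j))"
      by auto
    define m where "m = l(k := B - (\<Sum>i\<in>I. l i * A i))"
    have mI: "m i = l i" if "i \<in> I" for i
      using that insert.hyps by (auto simp: m_def)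
    have "(\<Sum>i\<in>I. l i * A i) \<le> 0"
      using A l(1) by (intro sum_nonpos) (auto simp: mult_nonneg_nonpos)
    then have "m k \<ge> 0"
      using B by (simp add: m_def)
    moreover have "b j = (\<Sum>i\<in>insert k I. m i * a i j)" if "j \<in> J" for j
    proof -
      have "b j = B * a k j + (\<Sum>i\<in>I. l i * (a i j - A i * a k j))"
        using l(2)[OF that] by simp
      also have "\<dots> = m k * a k j + (\<Sum>i\<in>I. l i * a i j)"
        by (simp add: m_def left_diff_distrib right_diff_distrib sum_subtractf sum_distrib_right mult.assoc)
      also have "\<dots> = (\<Sum>i\<in>insert k I. m i * a i j)"
        using insert.hyps mI by simp
      finally show ?thesis .
    qed
    ultimately show ?thesis
      using l(1) mI by (intro exI[of _ m]) auto
  qed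
qed

text \<open>
  A theorem of the alternative. It suffices to find, for each \<open>k\<close>, a vector \<open>\<theta> \<ge> 0\<close> with
  \<open>\<theta> N \<ge> 0\<close> and \<open>\<theta>\<^sub>k > 0\<close>: the sum of these vectors is positive in every entry. If there is none for
  \<open>k\<close>, then \<open>\<theta>\<^sub>k \<le> 0\<close> follows from \<open>\<theta> \<ge> 0\<close> and \<open>\<theta> N \<ge> 0\<close>, and the multipliers
  which Farkas' lemma attaches to the columns of \<open>N\<close> form \<open>x\<close>.
\<close>
lemma positive_row_vector_or_nonpos_image:
  fixes N :: "'a \<Rightarrow> 'a \<Rightarrow> real"
  assumes fin: "finite S"
    and no_x: "\<And>x k. (\<And>i. i \<in> S \<Longrightarrow> 0 \<le> x i) \<Longrightarrow> (\<And>j. j \<in> S \<Longrightarrow> (\<Sum>i\<in>S. N j i * x i) \<le> 0) \<Longrightarrow>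
      k \<in> S \<Longrightarrow> (\<Sum>i\<in>S. N k i * x i) < 0 \<Longrightarrow> False"
  shows "\<exists>\<theta>. (\<forall>i\<in>S. \<theta> i > 0) \<and> (\<forall>i\<in>S. (\<Sum>j\<in>S. \<theta> j * N j i) \<ge> 0)"
proof -
  have "\<exists>\<theta>. (\<forall>i\<in>S. \<theta> i \<ge> 0) \<and> (\<forall>i\<in>S. (\<Sum>j\<in>S. \<theta> j * N j i) \<ge> 0) \<and> \<theta> k > 0" if k: "k \<in> S" for k
  proof (rule ccontr)
    assume none: "\<not> ?thesis"
    define a where "a = case_sum (\<lambda>i j. if j = i then - 1 else 0) (\<lambda>i j. - N j i)"
    have "\<exists>l. (\<forall>i\<in>S <+> S. 0 \<le> l i) \<and>
        (\<forall>j\<in>S. (if j = k then 1 else 0) = (\<Sum>i\<in>S <+> S. l i * a i j))"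
    proof (rule farkas)
      fix \<theta> assume \<theta>: "\<And>i. i \<in> S <+> S \<Longrightarrow> (\<Sum>j\<in>S. a i j * \<theta> j) \<le> 0"
      have "\<theta> i \<ge> 0" if "i \<in> S" for i
      proof -
        have "(\<Sum>j\<in>S. a (Inl i) j * \<theta> j) = (\<Sum>j\<in>S. if j = i then - \<theta> j else 0)"
          by (intro sum.cong) (auto simp: a_def)
        then show ?thesis
          using \<theta>[of "Inl i"] that fin by auto
      qed
      moreover have "(\<Sum>j\<in>S. \<theta> j * N j i) \<ge> 0" if "i \<in> S" for i
        using \<theta>[of "Inr i"] that by (auto simp: a_def sum_negf mult.commute)
      ultimately have "\<theta> k \<le> 0"
        using not_ex[THEN iffD1, OF none, THEN spec[of _ \<theta>]] by (simp add: not_less)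
      moreover have "(\<Sum>j\<in>S. (if j = k then 1 else 0) * \<theta> j) = (\<Sum>j\<in>S. if j = k then \<theta> j else 0)"
        by (intro sum.cong) auto
      ultimately show "(\<Sum>j\<in>S. (if j = k then 1 else 0) * \<theta> j) \<le> 0"
        using fin k by auto
    qed (use fin in auto)
    then obtain l where "\<forall>i\<in>S <+> S. 0 \<le> l i"
        "\<forall>j\<in>S. (if j = k then 1 else 0) = (\<Sum>i\<in>S <+> S. l i * a i j)"
      by (elim exE conjE) (rule that)
    note l = this[rule_format]
    have image: "(\<Sum>i\<in>S. N j i * l (Inr i)) = - l (Inl j) - (if j = k then 1 else 0)" if j: "j \<in> S" for j
    proof -
      have "(\<Sum>i\<in>S. l (Inl i) * a (Inl i) j) = (\<Sum>i\<in>S. if i = j then - l (Inl i) else 0)"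
        by (intro sum.cong) (auto simp: a_def)
      moreover have "(\<Sum>i\<in>S. l (Inr i) * a (Inr i) j) = - (\<Sum>i\<in>S. N j i * l (Inr i))"
        by (simp add: a_def sum_negf mult.commute)
      ultimately have "(\<Sum>i\<in>S <+> S. l i * a i j) = - l (Inl j) - (\<Sum>i\<in>S. N j i * l (Inr i))"
        using fin j by (simp add: sum.Plus)
      then show ?thesis
        using l(2)[OF j] by simp
    qed
    show False
    proof (rule no_x[of "\<lambda>i. l (Inr i)" k])
      show "(\<Sum>i\<in>S. N j i * l (Inr i)) \<le> 0" if "j \<in> S" for j
        using image[OF that] l(1)[OF InlI, of j] that by (simp split: if_splits)
      show "(\<Sum>i\<in>S. N k i * l (Inr i)) < 0"
        using image[OF k] l(1)[OF InlI, of k] k by simp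
    qed (use l(1) k in auto)
  qed
  then obtain \<Theta> where \<Theta>: "\<And>k i. k \<in> S \<Longrightarrow> i \<in> S \<Longrightarrow> \<Theta> k i \<ge> 0"
      "\<And>k i. k \<in> S \<Longrightarrow> i \<in> S \<Longrightarrow> (\<Sum>j\<in>S. \<Theta> k j * N j i) \<ge> 0" "\<And>k. k \<in> S \<Longrightarrow> \<Theta> k k > 0"
    by metis
  define \<theta> where "\<theta> i = (\<Sum>k\<in>S. \<Theta> k i)" for i
  have "\<theta> i > 0" if "i \<in> S" for i
    unfolding \<theta>_def using \<Theta>(1,3) that fin by (intro sum_pos2[of _ i]) auto
  moreover have "(\<Sum>j\<in>S. \<theta> j * N j i) \<ge> 0" if "i \<in> S" for i
  proof -
    have "(\<Sum>j\<in>S. \<theta> j * N j i) = (\<Sum>k\<in>S. \<Sum>j\<in>S. \<Theta> k j * N j i)"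
      unfolding \<theta>_def sum_distrib_right by (rule sum.swap)
    then show ?thesis
      using \<Theta>(2) that by (simp add: sum_nonneg)
  qed
  ultimately show ?thesis
    by blast
qed

section \<open>Consequences of Young's inequality\<close>

text \<open>
  Young's inequality for the factors \<open>(c powr \<alpha>) * s\<close> and \<open>(c powr (1 - \<alpha>)) * t\<close>, whose product is
  \<open>c * s * t\<close> whatever the exponent \<open>\<alpha>\<close> is.
\<close>
lemma young_split_coefficient:
  fixes c s t p q \<alpha> :: real
  assumes "c \<ge> 0" "s \<ge> 0" "t \<ge> 0" "p > 1" "q > 1" "1 / p + 1 / q = 1"
  shows "c * s * t \<le> c powr (\<alpha> * p) * s powr p / p + c powr ((1 - \<alpha>) * q) * t powr q / q"
proof (cases "c = 0 \<or> s = 0 \<or> t = 0")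
  case True
  then show ?thesis
    using assms by auto
next
  case False
  then have pos: "c > 0" "s > 0" "t > 0"
    using assms by auto
  have "c * s * t = (c powr \<alpha> * s) * (c powr (1 - \<alpha>) * t)"
    using pos by (simp add: powr_diff)
  also have "\<dots> \<le> (c powr \<alpha> * s) powr p / p + (c powr (1 - \<alpha>) * t) powr q / q"
    using pos assms by (intro Youngs_inequality) auto
  also have "\<dots> = c powr (\<alpha> * p) * s powr p / p + c powr ((1 - \<alpha>) * q) * t powr q / q"
    using pos by (simp add: powr_mult powr_powr)
  finally show ?thesis .
qed

text \<open>
  The hypothesis \<open>young\<close> says that \<open>m\<^sub>j\<^sub>i\<close> is at most the weighted geometric mean of \<open>a\<^sub>j\<^sub>i\<close> and
  \<open>b\<^sub>j\<^sub>i\<close>. Testing \<open>bound\<close> against \<open>x\<^sub>i\<^sup>p\<close> compares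
  \<open>\<Sum>\<^sub>j \<xi>\<^sub>j x\<^sub>j\<^sup>p\<^sup>-\<^sup>1 (m x)\<^sub>j\<close> with \<open>\<Sum>\<^sub>j \<xi>\<^sub>j c\<^sub>j x\<^sub>j\<^sup>p\<close>. The hypothesis \<open>support\<close> serves the case \<open>x\<^sub>k = 0\<close>: the
  test weight \<open>x\<^sub>k\<^sup>p\<^sup>-\<^sup>1\<close> then hides the strict inequality in row \<open>k\<close>, but a positive \<open>m\<^sub>k\<^sub>i x\<^sub>i\<close> still makes
  the term \<open>a\<^sub>k\<^sub>i x\<^sub>i\<^sup>p\<close> on the larger side of Young's inequality positive.
\<close>
lemma no_nonpos_image:
  fixes a b m :: "'a \<Rightarrow> 'a \<Rightarrow> real" and c \<xi> x :: "'a \<Rightarrow> real" and p q :: real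
  assumes fin: "finite S"
    and p: "p > 1" and q: "q > 1" and pq: "1 / p + 1 / q = 1"
    and \<xi>: "\<And>i. i \<in> S \<Longrightarrow> \<xi> i > 0"
    and a: "\<And>i j. i \<in> S \<Longrightarrow> j \<in> S \<Longrightarrow> a i j \<ge> 0"
    and b: "\<And>i j. i \<in> S \<Longrightarrow> j \<in> S \<Longrightarrow> b i j \<ge> 0"
    and young: "\<And>i j s t. i \<in> S \<Longrightarrow> j \<in> S \<Longrightarrow> s \<ge> 0 \<Longrightarrow> t \<ge> 0 \<Longrightarrow>
      m i j * s * t \<le> a i j * s powr p / p + b i j * t powr q / q"
    and support: "\<And>i j. i \<in> S \<Longrightarrow> j \<in> S \<Longrightarrow> m i j > 0 \<Longrightarrow> a i j > 0"
    and bound: "\<And>i. i \<in> S \<Longrightarrow>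
      (\<Sum>j\<in>S - {i}. a j i * \<xi> j) / p + (\<Sum>j\<in>S - {i}. b i j) * \<xi> i / q \<le> c i * \<xi> i"
    and x: "\<And>i. i \<in> S \<Longrightarrow> x i \<ge> 0"
    and row: "\<And>j. j \<in> S \<Longrightarrow> c j * x j \<le> (\<Sum>i\<in>S - {j}. m j i * x i)"
    and k: "k \<in> S" and row_k: "c k * x k < (\<Sum>i\<in>S - {k}. m k i * x i)"
  shows False
proof -
  define R where "R j = (\<Sum>i\<in>S - {j}. a j i * x i powr p / p + b j i * x j powr p / q)" for j
  \<comment> \<open>Young's inequality is used with \<open>t = x\<^sub>j\<^sup>p\<^sup>-\<^sup>1\<close>, whose \<open>q\<close>-th power is \<open>x\<^sub>j\<^sup>p\<close>.\<close>
  have exponent: "(p - 1) * q = p"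
    using p q pq by (simp add: field_simps)
  have R_ge: "x j powr (p - 1) * (\<Sum>i\<in>S - {j}. m j i * x i) \<le> R j" if j: "j \<in> S" for j
    unfolding R_def sum_distrib_left
  proof (rule sum_mono)
    fix i assume "i \<in> S - {j}"
    then show "x j powr (p - 1) * (m j i * x i) \<le> a j i * x i powr p / p + b j i * x j powr p / q"
      using young[of j i "x i" "x j powr (p - 1)"] j x exponent
      by (simp add: powr_powr mult_ac)
  qed
  have cx: "c j * x j powr p = x j powr (p - 1) * (c j * x j)" if "j \<in> S" for j
    using x[OF that] p by (cases "x j = 0") (auto simp: powr_diff)
  have R_ge': "c j * x j powr p \<le> R j" if "j \<in> S" for j
    unfolding cx[OF that] using R_ge[OF that] mult_left_mono[OF row[OF that], of "x j powr (p - 1)"]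
    by simp
  have R_gt: "c k * x k powr p < R k"
  proof (cases "x k = 0")
    case False
    then have "x k powr (p - 1) > 0"
      by simp
    then show ?thesis
      unfolding cx[OF k] using R_ge[OF k] row_k by (smt (verit) mult_strict_left_mono)
  next
    case True
    then have "(\<Sum>i\<in>S - {k}. m k i * x i) > 0"
      using row_k by simp
    then obtain i where i: "i \<in> S - {k}" "m k i * x i > 0"
      by (meson not_less sum_nonpos)
    then have "m k i > 0" "x i > 0"
      using x[of i] by (auto simp: zero_less_mult_iff)
    then have "R k > 0"
      unfolding R_def using i(1) a b k fin p q support[of k i]
      by (intro sum_pos2[of _ i]) (auto intro!: add_pos_nonneg)
    then show ?thesis
      using True p by simp
  qed
  have swap: "(\<Sum>j\<in>S. \<Sum>i\<in>S - {j}. f j i) = (\<Sum>i\<in>S. \<Sum>j\<in>S - {i}. f j i)"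
    for f :: "'a \<Rightarrow> 'a \<Rightarrow> real"
  proof -
    have diff: "S - {j} = {i \<in> S. i \<noteq> j}" for j
      by auto
    have "(\<Sum>j\<in>S. \<Sum>i\<in>S - {j}. f j i) = (\<Sum>i\<in>S. \<Sum>j\<in>{j \<in> S. i \<noteq> j}. f j i)"
      unfolding diff by (rule sum.swap_restrict[OF fin fin])
    also have "\<dots> = (\<Sum>i\<in>S. \<Sum>j\<in>S - {i}. f j i)"
      by (intro sum.cong) auto
    finally show ?thesis .
  qed
  have "(\<Sum>j\<in>S. \<xi> j * (c j * x j powr p)) < (\<Sum>j\<in>S. \<xi> j * R j)"
    using fin k \<xi> R_ge' R_gt by (intro sum_strict_mono_ex1) (auto intro: mult_left_mono less_imp_le)
  also have "\<dots> = (\<Sum>j\<in>S. \<Sum>i\<in>S - {j}. a j i * \<xi> j * x i powr p / p)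
      + (\<Sum>j\<in>S. \<Sum>i\<in>S - {j}. b j i * \<xi> j * x j powr p / q)"
    by (simp add: R_def distrib_left sum_distrib_left sum.distrib mult_ac)
  also have "(\<Sum>j\<in>S. \<Sum>i\<in>S - {j}. a j i * \<xi> j * x i powr p / p)
      = (\<Sum>i\<in>S. \<Sum>j\<in>S - {i}. a j i * \<xi> j * x i powr p / p)"
    by (rule swap)
  also have "\<dots> + (\<Sum>j\<in>S. \<Sum>i\<in>S - {j}. b j i * \<xi> j * x j powr p / q)
      = (\<Sum>i\<in>S. x i powr p *
          ((\<Sum>j\<in>S - {i}. a j i * \<xi> j) / p + (\<Sum>j\<in>S - {i}. b i j) * \<xi> i / q))"
    by (simp add: distrib_left sum.distrib sum_distrib_left sum_distrib_right sum_divide_distrib mult_ac)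
  also have "\<dots> \<le> (\<Sum>i\<in>S. x i powr p * (c i * \<xi> i))"
    using bound by (intro sum_mono mult_left_mono) auto
  also have "\<dots> = (\<Sum>j\<in>S. \<xi> j * (c j * x j powr p))"
    by (simp add: mult_ac)
  finally show False
    by simp
qed

section \<open>Existence of the weights\<close>

theorem theorem4:
  fixes n :: nat
    and c G F \<xi> :: "nat \<Rightarrow> real"
    and C D E \<alpha> \<beta> :: "nat \<Rightarrow> nat \<Rightarrow> real"
    and p q :: real
  assumes "\<And>i. i \<in> {1..n} \<Longrightarrow> c i > 0"
    and "\<And>i. i \<in> {1..n} \<Longrightarrow> G i > 0"
    and "\<And>i. i \<in> {1..n} \<Longrightarrow> F i > 0"
    and "\<And>i j. i \<in> {1..n} \<Longrightarrow> j \<in> {1..n} \<Longrightarrow> C i j \<ge> 0"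
    and "\<And>i j. i \<in> {1..n} \<Longrightarrow> j \<in> {1..n} \<Longrightarrow> D i j \<ge> 0"
    and "\<And>i j. i \<in> {1..n} \<Longrightarrow> j \<in> {1..n} \<Longrightarrow> E i j \<ge> 0"
    and "\<And>i. i \<in> {1..n} \<Longrightarrow> \<xi> i > 0"
    and "p > 1" and "q > 1" and "1 / p + 1 / q = 1"
    and "\<And>i. i \<in> {1..n} \<Longrightarrow>
      - c i * \<xi> i
      + 1 / p * (\<Sum>j\<in>{1..n} - {i}. C j i powr (\<alpha> j i * p) * G i * \<xi> j)
      + 1 / q * (\<Sum>j\<in>{1..n} - {i}. C i j powr ((1 - \<alpha> i j) * q) * G j * \<xi> i)
      + 1 / p * (\<Sum>j\<in>{1..n} - {i}. D j i powr (\<beta> j i * p) * E j i * F i * \<xi> j)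
      + 1 / q * (\<Sum>j\<in>{1..n} - {i}. D i j powr ((1 - \<beta> i j) * q) * E i j * F j * \<xi> i)
      \<le> 0"
  shows "\<exists>\<theta> :: nat \<Rightarrow> real.
      (\<forall>i\<in>{1..n}. \<theta> i > 0) \<and>
      (\<forall>i\<in>{1..n}.
        - c i * \<theta> i
        + G i * (\<Sum>j\<in>{1..n} - {i}. \<theta> j * C j i)
        + F i * (\<Sum>j\<in>{1..n} - {i}. \<theta> j * D j i * E j i)
        \<le> 0)"
proof -
  note pos = assms(1-7) and p = assms(8) and q = assms(9) and pq = assms(10) and hyp = assms(11)
  let ?S = "{1..n}"
  define m where "m j i = G i * C j i + F i * (D j i * E j i)" for j i
  \<comment> \<open>\<open>a\<close> collects the coefficients that come with \<open>1/p\<close>, \<open>b\<close> those that come with \<open>1/q\<close>.\<close>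
  define a where "a j i = G i * C j i powr (\<alpha> j i * p) + F i * E j i * D j i powr (\<beta> j i * p)" for j i
  define b where "b j i = G i * C j i powr ((1 - \<alpha> j i) * q)
    + F i * E j i * D j i powr ((1 - \<beta> j i) * q)" for j i
  have young: "m j i * s * t \<le> a j i * s powr p / p + b j i * t powr q / q"
    if "j \<in> ?S" "i \<in> ?S" "s \<ge> 0" "t \<ge> 0" for j i s t
  proof -
    have "m j i * s * t = G i * (C j i * s * t) + F i * E j i * (D j i * s * t)"
      by (simp add: m_def algebra_simps)
    also have "\<dots> \<le> G i * (C j i powr (\<alpha> j i * p) * s powr p / p
          + C j i powr ((1 - \<alpha> j i) * q) * t powr q / q)
        + F i * E j i * (D j i powr (\<beta> j i * p) * s powr p / p
          + D j i powr ((1 - \<beta> j i) * q) * t powr q / q)"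
      using that pos p q pq
      by (intro add_mono mult_left_mono young_split_coefficient)
        (auto intro!: mult_nonneg_nonneg intro: less_imp_le)
    also have "\<dots> = a j i * s powr p / p + b j i * t powr q / q"
      by (simp add: a_def b_def algebra_simps add_divide_distrib)
    finally show ?thesis .
  qed
  have a_nonneg: "a j i \<ge> 0" and b_nonneg: "b j i \<ge> 0" if "j \<in> ?S" "i \<in> ?S" for j i
    using that pos by (auto simp: a_def b_def less_imp_le)
  have support: "a j i > 0" if "j \<in> ?S" "i \<in> ?S" "m j i > 0" for j i
  proof -
    have "C j i > 0 \<or> D j i > 0 \<and> E j i > 0"
      using that pos(4,5,6)[of j i] by (auto simp: m_def less_le)
    then show ?thesis
      using that pos(2,3)[of i] pos(4,5,6)[of j i]
      by (auto simp: a_def intro: add_pos_nonneg add_nonneg_pos)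
  qed
  have bound: "(\<Sum>j\<in>?S - {i}. a j i * \<xi> j) / p + (\<Sum>j\<in>?S - {i}. b i j) * \<xi> i / q \<le> c i * \<xi> i"
    if "i \<in> ?S" for i
    using hyp[OF that]
    by (simp add: a_def b_def sum.distrib sum_distrib_left sum_distrib_right add_divide_distrib
        sum_divide_distrib algebra_simps)
  define N where "N j i = (if i = j then c i else - m j i)" for j i
  have N_row: "(\<Sum>i\<in>?S. N j i * x i) = c j * x j - (\<Sum>i\<in>?S - {j}. m j i * x i)"
    if "j \<in> ?S" for j and x :: "nat \<Rightarrow> real"
  proof -
    have "(\<Sum>i\<in>?S - {j}. N j i * x i) = (\<Sum>i\<in>?S - {j}. - (m j i * x i))"
      by (intro sum.cong) (auto simp: N_def)
    then show ?thesis
      using that by (simp add: sum.remove[of _ j] sum_negf N_def)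
  qed
  have "\<exists>\<theta>. (\<forall>i\<in>?S. \<theta> i > 0) \<and> (\<forall>i\<in>?S. (\<Sum>j\<in>?S. \<theta> j * N j i) \<ge> 0)"
  proof (rule positive_row_vector_or_nonpos_image)
    fix x k
    assume x: "\<And>i. i \<in> ?S \<Longrightarrow> 0 \<le> x i" "\<And>j. j \<in> ?S \<Longrightarrow> (\<Sum>i\<in>?S. N j i * x i) \<le> 0"
      and k: "k \<in> ?S" "(\<Sum>i\<in>?S. N k i * x i) < 0"
    show False
    proof (rule no_nonpos_image[of ?S p q \<xi> a b m c x k])
      show "c j * x j \<le> (\<Sum>i\<in>?S - {j}. m j i * x i)" if "j \<in> ?S" for j
        using x(2)[OF that] N_row[OF that, of x] by simp
      show "c k * x k < (\<Sum>i\<in>?S - {k}. m k i * x i)"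
        using k(2) N_row[OF k(1), of x] by simp
    qed (fact p q pq pos(7) a_nonneg b_nonneg young support bound x(1) k(1) finite_atLeastAtMost)+
  qed simp
  then obtain \<theta> where \<theta>: "\<And>i. i \<in> ?S \<Longrightarrow> \<theta> i > 0" "\<And>i. i \<in> ?S \<Longrightarrow> (\<Sum>j\<in>?S. \<theta> j * N j i) \<ge> 0"
    by blast
  have "- c i * \<theta> i + G i * (\<Sum>j\<in>?S - {i}. \<theta> j * C j i)
      + F i * (\<Sum>j\<in>?S - {i}. \<theta> j * D j i * E j i) \<le> 0" if i: "i \<in> ?S" for i
  proof -
    have "(\<Sum>j\<in>?S - {i}. \<theta> j * N j i) = (\<Sum>j\<in>?S - {i}. - (\<theta> j * m j i))"
      by (intro sum.cong) (auto simp: N_def)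
    then have "(\<Sum>j\<in>?S. \<theta> j * N j i) = c i * \<theta> i - (\<Sum>j\<in>?S - {i}. \<theta> j * m j i)"
      using i by (simp add: sum.remove[of _ i] sum_negf N_def)
    moreover have "(\<Sum>j\<in>?S - {i}. \<theta> j * m j i) = G i * (\<Sum>j\<in>?S - {i}. \<theta> j * C j i)
        + F i * (\<Sum>j\<in>?S - {i}. \<theta> j * D j i * E j i)"
      by (simp add: m_def sum.distrib sum_distrib_left algebra_simps)
    ultimately show ?thesis
      using \<theta>(2)[OF i] by simp
  qed
  with \<theta>(1) show ?thesis
    by blast
qed

end
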